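(* Let $n\ge 3$, $m\ge n$, and $a=m-n+2\ge 2$. Let $\mathcal{T}(n,m;a,1,\dots,1)$ be the set of all weighted trees on $n$ vertices whose edge weights consist of one edge of weight $a$ and $n-2$ edges of weight $1$. Let $P_n^*$ be the weighted path on $n$ vertices in which one pendent edge has weight $a$ and all other edges have weight $1$. Then for every $T\in\mathcal{T}(n,m;a,1,\dots,1)$ with $T\neq P_n^*$ (as weighted graphs), $T\prec P_n^*$.
   Context: For a weighted bipartite graph $G$ of order $n$, $b_k(G)$ is the sum, over all matchings of $G$ with $k$ edges, of the product of the squares of the weights of the edges of the matching. For weighted bipartite graphs $G_1,G_2$ of order $n$, $G_1\preceq G_2$ means $b_k(G_1)\le b_k(G_2)$ for all $1\le k\le\lfloor n/2\rfloor$, and $G_1\prec G_2$ means $G_1\preceq G_2$ with $b_j(G_1)<b_j(G_2)$ for at least one $j$. A pendent edge is an edge incident to a vertex of degree $1$. *)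

theory Defs
  imports Complex_Main "HOL-Library.Multiset"
begin

text \<open>
  Simple undirected weighted graphs. Edges are two-element vertex sets; only the values of
  \<open>weight\<close> on edges are meaningful.
\<close>

record 'a wgraph =
  verts :: "'a set"
  edges :: "'a set set"
  weight :: "'a set \<Rightarrow> real"

definition weighted_graph :: "nat \<Rightarrow> 'a wgraph \<Rightarrow> bool" where
  "weighted_graph n G \<longleftrightarrow>
     finite (verts G) \<and> card (verts G) = n \<and>
     (\<forall>e\<in>edges G. \<exists>u\<in>verts G. \<exists>v\<in>verts G. u \<noteq> v \<and> e = {u, v})"

definition bipartite :: "'a wgraph \<Rightarrow> bool" where
  "bipartite G \<longleftrightarrow>
     (\<exists>A B. A \<union> B = verts G \<and> A \<inter> B = {} \<and> (\<forall>e\<in>edges G. \<exists>u\<in>A. \<exists>v\<in>B. e = {u, v}))"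

definition walk :: "'a wgraph \<Rightarrow> 'a list \<Rightarrow> bool" where
  "walk G xs \<longleftrightarrow>
     xs \<noteq> [] \<and> set xs \<subseteq> verts G \<and> successively (\<lambda>u v. {u, v} \<in> edges G) xs"

definition connected_graph :: "'a wgraph \<Rightarrow> bool" where
  "connected_graph G \<longleftrightarrow>
     verts G \<noteq> {} \<and>
     (\<forall>u\<in>verts G. \<forall>v\<in>verts G. \<exists>xs. walk G xs \<and> hd xs = u \<and> last xs = v)"

text \<open>The first vertex of a cycle is not repeated at the end of the list.\<close>

definition cycle :: "'a wgraph \<Rightarrow> 'a list \<Rightarrow> bool" where
  "cycle G xs \<longleftrightarrow>
     length xs \<ge> 3 \<and> distinct xs \<and> walk G xs \<and> {last xs, hd xs} \<in> edges G"

definition weighted_tree :: "nat \<Rightarrow> 'a wgraph \<Rightarrow> bool" where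
  "weighted_tree n G \<longleftrightarrow> weighted_graph n G \<and> connected_graph G \<and> (\<nexists>xs. cycle G xs)"

definition degree :: "'a wgraph \<Rightarrow> 'a \<Rightarrow> nat" where
  "degree G v = card {e \<in> edges G. v \<in> e}"

definition pendent_edge :: "'a wgraph \<Rightarrow> 'a set \<Rightarrow> bool" where
  "pendent_edge G e \<longleftrightarrow> e \<in> edges G \<and> (\<exists>v\<in>e. degree G v = 1)"

definition matching :: "'a wgraph \<Rightarrow> 'a set set \<Rightarrow> bool" where
  "matching G M \<longleftrightarrow> M \<subseteq> edges G \<and> pairwise disjnt M"

definition b_coeff :: "nat \<Rightarrow> 'a wgraph \<Rightarrow> real" where
  "b_coeff k G = (\<Sum>M | matching G M \<and> finite M \<and> card M = k. \<Prod>e\<in>M. (weight G e)\<^sup>2)"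

text \<open>
  The comparison relations are only defined between weighted bipartite graphs of the same
  order \<open>n\<close>, so membership in that class is part of the relation. The two graphs may have
  different vertex types.
\<close>

definition b_preceq :: "nat \<Rightarrow> 'a wgraph \<Rightarrow> 'b wgraph \<Rightarrow> bool" where
  "b_preceq n G H \<longleftrightarrow>
     weighted_graph n G \<and> bipartite G \<and> weighted_graph n H \<and> bipartite H \<and>
     (\<forall>k\<in>{1..n div 2}. b_coeff k G \<le> b_coeff k H)"

definition b_prec :: "nat \<Rightarrow> 'a wgraph \<Rightarrow> 'b wgraph \<Rightarrow> bool" where
  "b_prec n G H \<longleftrightarrow> b_preceq n G H \<and> (\<exists>j\<in>{1..n div 2}. b_coeff j G < b_coeff j H)"

definition weighted_iso :: "'a wgraph \<Rightarrow> 'b wgraph \<Rightarrow> bool" where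
  "weighted_iso G H \<longleftrightarrow>
     (\<exists>f. bij_betw f (verts G) (verts H) \<and> edges H = (\<lambda>e. f ` e) ` edges G \<and>
          (\<forall>e\<in>edges G. weight H (f ` e) = weight G e))"

definition trees_with_weights :: "nat \<Rightarrow> real multiset \<Rightarrow> 'a wgraph set" where
  "trees_with_weights n W =
     {T. weighted_tree n T \<and> image_mset (weight T) (mset_set (edges T)) = W}"

text \<open>The path \<open>0, 1, \<dots>, n - 1\<close>, with weight \<open>a\<close> on the pendent edge \<open>{0, 1}\<close>.\<close>

definition path_star :: "nat \<Rightarrow> real \<Rightarrow> nat wgraph" where
  "path_star n a =
     \<lparr>verts = {..<n},
      edges = {{i, Suc i} | i. Suc i < n},
      weight = (\<lambda>e. if e = {0, 1} then a else 1)\<rparr>"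

lemma pendent_edge_path_star:
  assumes "n \<ge> 2"
  shows "pendent_edge (path_star n a) {0, 1}"
proof -
  have "{e \<in> edges (path_star n a). 0 \<in> e} = {{0, 1}}"
    using assms by (auto simp: path_star_def)
  then show ?thesis
    using assms by (force simp: pendent_edge_def degree_def path_star_def)
qed

end

theory Submission imports Defs begin

text \<open>
  Expanding along the heavy edge \<open>e\<close> gives \<open>b\<^sub>k(T) = m\<^sub>k(T) + (a\<^sup>2 - 1) m\<^sub>k\<^sub>-\<^sub>1(T - e)\<close>, where \<open>m\<^sub>k\<close> counts
  \<open>k\<close>-matchings and \<open>T - e\<close> is \<open>T\<close> without both ends of \<open>e\<close>. Removing leaves one by one shows that a
  forest on \<open>n\<close> vertices has at most \<open>n - k choose k\<close> matchings of size \<open>k\<close>, which is the value for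
  the path, and this bounds both terms. The inequality is strict at \<open>k = 2\<close>: a vertex of degree at
  least \<open>3\<close> makes \<open>m\<^sub>2(T)\<close> smaller, and if \<open>e\<close> is not pendent then \<open>T - e\<close> has too few edges.
\<close>

subsection \<open>Weighted matching sums of edge sets\<close>

definition matchings :: "nat \<Rightarrow> 'a set set \<Rightarrow> 'a set set set" where
  "matchings k E = {M. M \<subseteq> E \<and> pairwise disjnt M \<and> finite M \<and> card M = k}"

definition matching_sum :: "('a set \<Rightarrow> real) \<Rightarrow> nat \<Rightarrow> 'a set set \<Rightarrow> real" where
  "matching_sum w k E = (\<Sum>M\<in>matchings k E. \<Prod>e\<in>M. (w e)\<^sup>2)"

text \<open>With all weights 1 every product is 1, so this counts matchings; the count is kept real
  so that it combines with weighted sums.\<close>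

abbreviation matching_number :: "nat \<Rightarrow> 'a set set \<Rightarrow> real" where
  "matching_number \<equiv> matching_sum (\<lambda>_. 1)"

lemma b_coeff_eq_matching_sum: "b_coeff k G = matching_sum (weight G) k (edges G)"
  by (simp add: b_coeff_def matching_sum_def matchings_def matching_def)

lemma matching_sum_0 [simp]: "matching_sum w 0 E = 1"
proof -
  have "matchings 0 E = {{}}"
    by (auto simp: matchings_def)
  then show ?thesis
    by (simp add: matching_sum_def)
qed

lemma matching_sum_empty [simp]: "k > 0 \<Longrightarrow> matching_sum w k {} = 0"
  unfolding matching_sum_def matchings_def by (intro sum.neutral) auto

lemma matching_sum_cong:
  "(\<And>e. e \<in> E \<Longrightarrow> w e = w' e) \<Longrightarrow> matching_sum w k E = matching_sum w' k E"
  unfolding matching_sum_def matchings_def by (intro sum.cong prod.cong refl) auto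

text \<open>A matching either avoids \<open>e\<close>, or consists of \<open>e\<close> and a smaller
  matching among the edges disjoint from it. Since \<open>disjnt {} {}\<close> holds,
  \<open>e \<noteq> {}\<close> is what keeps \<open>e\<close> itself out of the second edge
  set.\<close>

lemma matchings_Suc:
  assumes "e \<in> E" "e \<noteq> {}"
  shows "matchings (Suc k) E =
    matchings (Suc k) (E - {e}) \<union> insert e ` matchings k {f \<in> E. disjnt e f}"
    (is "_ = ?A \<union> insert e ` ?C")
proof (intro equalityI subsetI)
  fix M assume M: "M \<in> matchings (Suc k) E"
  show "M \<in> ?A \<union> insert e ` ?C"
  proof (cases "e \<in> M")
    case True
    have "M - {e} \<in> ?C"
      using M True by (auto simp: matchings_def pairwise_def)
    moreover have "M = insert e (M - {e})"
      using True by blast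
    ultimately show ?thesis
      by blast
  qed (use M in \<open>auto simp: matchings_def\<close>)
next
  fix M assume "M \<in> ?A \<union> insert e ` ?C"
  then show "M \<in> matchings (Suc k) E"
  proof
    assume "M \<in> insert e ` ?C"
    then obtain N where N: "M = insert e N" "N \<in> ?C" by blast
    then have "\<forall>f\<in>N. f \<in> E \<and> disjnt e f" "pairwise disjnt N" "finite N" "card N = k"
      by (auto simp: matchings_def)
    moreover from this have "e \<notin> N"
      using assms(2) by auto
    ultimately show ?thesis
      using N(1) assms(1) by (auto simp: matchings_def pairwise_insert disjnt_sym)
  qed (auto simp: matchings_def)
qed

text \<open>The deletion recurrence of matching polynomials: the two families in
  \<open>matchings_Suc\<close> are disjoint, and adding \<open>e\<close> to a matching multiplies
  its product by \<open>(w e)\<^sup>2\<close>.\<close>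

lemma matching_sum_deletion:
  assumes "finite E" "e \<in> E" "e \<noteq> {}"
  shows "matching_sum w (Suc k) E =
    matching_sum w (Suc k) (E - {e}) + (w e)\<^sup>2 * matching_sum w k {f \<in> E. disjnt e f}"
proof -
  let ?p = "\<lambda>M. \<Prod>e\<in>M. (w e)\<^sup>2"
  let ?A = "matchings (Suc k) (E - {e})"
  let ?C = "matchings k {f \<in> E. disjnt e f}"
  have C: "e \<notin> M \<and> finite M" if "M \<in> ?C" for M
    using that assms(3) by (auto simp: matchings_def)
  have A: "e \<notin> M" if "M \<in> ?A" for M
    using that by (auto simp: matchings_def)
  have fin: "finite ?A" "finite ?C"
    using assms(1) by (auto simp: matchings_def intro: finite_subset[of _ "Pow E"])
  have inj: "inj_on (insert e) ?C"
    by (rule inj_onI) (metis C insert_ident)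
  have "matching_sum w (Suc k) E = sum ?p ?A + sum ?p (insert e ` ?C)"
    unfolding matching_sum_def matchings_Suc[OF assms(2,3)]
    using fin A by (intro sum.union_disjoint) auto
  also have "sum ?p (insert e ` ?C) = (\<Sum>M\<in>?C. (w e)\<^sup>2 * ?p M)"
    unfolding sum.reindex[OF inj] using C by (intro sum.cong) auto
  finally show ?thesis
    by (simp add: matching_sum_def sum_distrib_left)
qed

text \<open>Apply the deletion recurrence once with \<open>w\<close> and once with constant weight
  1. Neither remaining edge set contains \<open>e\<close>, so the expansions differ only in the
  factor of the second term.\<close>

lemma matching_sum_heavy_edge:
  assumes "finite E" "e \<in> E" "e \<noteq> {}" "\<And>f. f \<in> E - {e} \<Longrightarrow> w f = 1"
  shows "matching_sum w (Suc k) E =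
    matching_number (Suc k) E + ((w e)\<^sup>2 - 1) * matching_number k {f \<in> E. disjnt e f}"
proof -
  have "matching_sum w (Suc k) (E - {e}) = matching_number (Suc k) (E - {e})"
    "matching_sum w k {f \<in> E. disjnt e f} = matching_number k {f \<in> E. disjnt e f}"
    using assms(3,4) by (auto intro!: matching_sum_cong simp: disjnt_def)
  then show ?thesis
    using matching_sum_deletion[OF assms(1-3), of w k]
      matching_sum_deletion[OF assms(1-3), of "\<lambda>_. 1" k]
    by (simp add: algebra_simps)
qed

lemma matching_number_1:
  assumes "finite E" "{} \<notin> E"
  shows "matching_number 1 E = card E"
  using assms
proof (induction E rule: finite_induct)
  case (insert e E)
  then show ?case
    using matching_sum_deletion[of "insert e E" e "\<lambda>_. 1" 0]
    by (cases "e = {}") auto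
qed simp

subsection \<open>Forests\<close>

text \<open>
  Acyclicity in the form that is inherited by subsets of the edge set and provides leaves.
\<close>

definition forest :: "'a set set \<Rightarrow> bool" where
  "forest E \<longleftrightarrow> (\<forall>E'\<subseteq>E. E' \<noteq> {} \<longrightarrow> (\<exists>v. \<exists>e\<in>E'. v \<in> e \<and> (\<forall>f\<in>E'. v \<in> f \<longrightarrow> f = e)))"

definition edges_on :: "'a set \<Rightarrow> 'a set set \<Rightarrow> bool" where
  "edges_on V E \<longleftrightarrow> (\<forall>e\<in>E. \<exists>u\<in>V. \<exists>v\<in>V. u \<noteq> v \<and> e = {u, v})"

lemma forest_subset: "forest E \<Longrightarrow> E' \<subseteq> E \<Longrightarrow> forest E'"
  by (auto simp: forest_def)

lemma edges_onE:
  assumes "edges_on V E" "e \<in> E"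
  obtains u v where "u \<in> V" "v \<in> V" "u \<noteq> v" "e = {u, v}"
  using assms unfolding edges_on_def by blast

lemma edges_onE_at:
  assumes "edges_on V E" "e \<in> E" "u \<in> e"
  obtains v where "u \<in> V" "v \<in> V" "u \<noteq> v" "e = {u, v}"
proof -
  obtain x y where xy: "x \<in> V" "y \<in> V" "x \<noteq> y" "e = {x, y}"
    using edges_onE[OF assms(1,2)] .
  show thesis
  proof (cases "u = x")
    case False
    then have "u = y" using assms(3) xy by auto
    then show thesis using that[of x] xy by auto
  qed (use that[of y] xy in auto)
qed

lemma edges_on_finite: "edges_on V E \<Longrightarrow> finite V \<Longrightarrow> finite E"
  by (rule finite_subset[of _ "Pow V"]) (auto simp: edges_on_def)

lemma edges_on_nonempty: "edges_on V E \<Longrightarrow> {} \<notin> E"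
  by (auto simp: edges_on_def)

lemma edges_on_disjnt:
  assumes "edges_on V E"
  shows "edges_on (V - e) {f \<in> E. disjnt e f}"
  unfolding edges_on_def
proof
  fix f assume f: "f \<in> {f \<in> E. disjnt e f}"
  then obtain a b where ab: "a \<in> V" "b \<in> V" "a \<noteq> b" "f = {a, b}"
    using edges_onE[OF assms] by blast
  then have "a \<in> V - e" "b \<in> V - e"
    using f by (auto simp: disjnt_def)
  then show "\<exists>u\<in>V - e. \<exists>v\<in>V - e. u \<noteq> v \<and> f = {u, v}"
    using ab by blast
qed

text \<open>Packages the step of all inductions on forests. Dropping the edge at the leaf
  \<open>v\<close> isolates \<open>v\<close>, since it was the only edge there; dropping every edge
  that meets it frees both ends.\<close>

lemma forest_leaf:
  assumes "forest E" "edges_on V E" "E \<noteq> {}"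
  obtains v w where "v \<in> V" "w \<in> V" "v \<noteq> w" "{v, w} \<in> E" "\<forall>f\<in>E. v \<in> f \<longrightarrow> f = {v, w}"
    "edges_on (V - {v}) (E - {{v, w}})" "edges_on (V - {v, w}) {f \<in> E. disjnt {v, w} f}"
proof -
  obtain v e where e: "e \<in> E" "v \<in> e" and ve: "\<forall>f\<in>E. v \<in> f \<longrightarrow> f = e"
    using assms(1,3) unfolding forest_def by (metis subset_refl)
  obtain w where w: "v \<in> V" "w \<in> V" "v \<noteq> w" "e = {v, w}"
    using edges_onE_at[OF assms(2) e] .
  have "edges_on (V - {v}) (E - {{v, w}})"
    unfolding edges_on_def
  proof
    fix f assume f: "f \<in> E - {{v, w}}"
    then obtain a b where "a \<in> V" "b \<in> V" "a \<noteq> b" "f = {a, b}"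
      using edges_onE[OF assms(2)] by blast
    moreover have "v \<notin> f" using f ve w(4) by blast
    ultimately show "\<exists>u\<in>V - {v}. \<exists>v'\<in>V - {v}. u \<noteq> v' \<and> f = {u, v'}"
      by (intro bexI[of _ a] bexI[of _ b]) auto
  qed
  then show thesis
    by (rule that[OF w(1-3) e(1)[unfolded w(4)] ve[unfolded w(4)] _ edges_on_disjnt[OF assms(2)]])
qed

section \<open>Extremal bounds and 2-colourings by removing leaves\<close>

text \<open>Pascal's rule when \<open>Suc k < n\<close>. Beyond that, truncated subtraction makes
  both sides 0: there \<open>n \<ge> 2\<close> excludes \<open>k = 0\<close>, where
  \<open>0 choose 0 = 1\<close> would spoil the equation.\<close>

lemma choose_step:
  assumes "n \<ge> 2"
  shows "n - Suc k choose Suc k = ((n - 1 - Suc k) choose Suc k) + ((n - 2 - k) choose k)"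
proof (cases "Suc k < n")
  case True
  then have "n - Suc k = Suc (n - 2 - k)" by simp
  then show ?thesis by (simp add: add.commute)
next
  case False
  then show ?thesis using assms by (cases k) auto
qed

text \<open>Deleting a leaf edge, alone or with all edges that meet it, leaves forests on one and
  two fewer vertices. By \<open>choose_step\<close> the bounds satisfy the recurrence of the
  matching numbers.\<close>

lemma matching_number_forest_le:
  assumes "finite V" "forest E" "edges_on V E"
  shows "matching_number k E \<le> card V - k choose k"
  using assms
proof (induction "card V" arbitrary: V E k rule: less_induct)
  case less
  have fin: "finite E"
    using less.prems edges_on_finite by blast
  show ?case
  proof (cases k)
    case (Suc j)
    show ?thesis
    proof (cases "E = {}")
      case False
      obtain v w where vw: "v \<in> V" "w \<in> V" "v \<noteq> w" "{v, w} \<in> E" "\<forall>f\<in>E. v \<in> f \<longrightarrow> f = {v, w}"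
        "edges_on (V - {v}) (E - {{v, w}})" "edges_on (V - {v, w}) {f \<in> E. disjnt {v, w} f}"
        by (rule forest_leaf[OF less.prems(2,3) False]) (rule that)
      have card: "card (V - {v}) = card V - 1" "card (V - {v, w}) = card V - 2"
        using vw(1-3) less.prems(1) by (auto simp: card_Diff_subset)
      have "card {v, w} \<le> card V"
        using vw(1-3) less.prems(1) by (intro card_mono) auto
      then have ge: "card V \<ge> 2"
        using vw(3) by simp
      have "matching_number (Suc j) (E - {{v, w}}) \<le> (card V - 1) - Suc j choose Suc j"
        using less.hyps[of "V - {v}" "E - {{v, w}}" "Suc j"] less.prems(1)
          forest_subset[OF less.prems(2), of "E - {{v, w}}"] vw(6) card ge by auto
      moreover have "matching_number j {f \<in> E. disjnt {v, w} f} \<le> (card V - 2) - j choose j"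
        using less.hyps[of "V - {v, w}" "{f \<in> E. disjnt {v, w} f}" j] less.prems(1)
          forest_subset[OF less.prems(2), of "{f \<in> E. disjnt {v, w} f}"] vw(7) card ge
        by (auto simp del: disjnt_insert1)
      ultimately show ?thesis
        using matching_sum_deletion[OF fin vw(4), of "\<lambda>_. 1" j] Suc choose_step[OF ge, of j]
        by simp
    qed (simp add: Suc)
  qed simp
qed

text \<open>The case \<open>k = 1\<close> of the matching bound.\<close>

lemma card_forest_le:
  assumes "finite V" "forest E" "edges_on V E"
  shows "card E \<le> card V - 1"
  using matching_number_forest_le[OF assms, of 1] matching_number_1[of E]
    edges_on_finite[OF assms(3,1)] edges_on_nonempty[OF assms(3)]
  by simp

text \<open>Remove a leaf edge \<open>{v, w}\<close>; the leaf \<open>v\<close> cannot be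
  \<open>x\<close>. If \<open>x = w\<close>, too few edges avoid \<open>{v, w}\<close> and the
  second term of the recurrence is strict. Otherwise \<open>x\<close> keeps its degree and the
  induction hypothesis makes the first term strict.\<close>

lemma matching_number_2_forest_less:
  assumes "finite V" "forest E" "edges_on V E" "card {f \<in> E. x \<in> f} \<ge> 3"
  shows "matching_number 2 E < card V - 2 choose 2"
  using assms
proof (induction "card V" arbitrary: V E rule: less_induct)
  case less
  have fin: "finite E"
    using less.prems edges_on_finite by blast
  have nonempty: "E \<noteq> {}"
    using less.prems(4) by auto
  obtain v w where vw: "v \<in> V" "w \<in> V" "v \<noteq> w" "{v, w} \<in> E" "\<forall>f\<in>E. v \<in> f \<longrightarrow> f = {v, w}"
    "edges_on (V - {v}) (E - {{v, w}})" "edges_on (V - {v, w}) {f \<in> E. disjnt {v, w} f}"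
    by (rule forest_leaf[OF less.prems(2,3) nonempty]) (rule that)
  let ?D = "{f \<in> E. disjnt {v, w} f}"
  have card: "card (V - {v}) = card V - 1" "card (V - {v, w}) = card V - 2"
    using vw(1-3) less.prems(1) by (auto simp: card_Diff_subset)
  \<comment> \<open>Three edges in a forest need four vertices, so the subtractions below are not
    truncated.\<close>
  have "card {f \<in> E. x \<in> f} \<le> card E"
    using fin by (intro card_mono) auto
  then have ge: "card V \<ge> 4"
    using less.prems(4) card_forest_le[OF less.prems(1-3)] by linarith
  have del: "matching_number 2 E =
      matching_number 2 (E - {{v, w}}) + matching_number 1 ?D"
    using matching_sum_deletion[OF fin vw(4), of "\<lambda>_. 1" 1] by (simp del: One_nat_def)
  have D: "matching_number 1 ?D = card ?D"
    using fin edges_on_nonempty[OF vw(7)] by (intro matching_number_1) auto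
  have step: "card V - 2 choose 2 = (card V - 1 - 2 choose 2) + (card V - 3)"
    using choose_step[of "card V" 1] ge by (simp add: choose_one del: One_nat_def)
  have "forest (E - {{v, w}})" "forest ?D"
    using forest_subset[OF less.prems(2)] by auto
  note F = this
  show ?case
  proof (cases "x = w")
    case True
    \<comment> \<open>All edges at \<open>x\<close> meet \<open>{v, w}\<close>, so at least three of
      at most \<open>card V - 1\<close> edges are lost.\<close>
    have "card ?D \<le> card (E - {f \<in> E. x \<in> f})"
      using True fin by (intro card_mono) (auto simp: disjnt_def)
    also have "\<dots> = card E - card {f \<in> E. x \<in> f}"
      using fin by (intro card_Diff_subset) auto
    also have "\<dots> < card V - 3"
      using less.prems(4) card_forest_le[OF less.prems(1-3)] ge by linarith
    finally show ?thesis
      using matching_number_forest_le[OF _ F(1) vw(6), of 2] less.prems(1) card(1) del D step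
      by simp
  next
    case False
    have "x \<noteq> v"
    proof
      assume "x = v"
      then have "{f \<in> E. x \<in> f} \<subseteq> {{v, w}}"
        using vw(5) by blast
      then show False
        using less.prems(4) card_mono[of "{{v, w}}" "{f \<in> E. x \<in> f}"] by simp
    qed
    then have "{f \<in> E - {{v, w}}. x \<in> f} = {f \<in> E. x \<in> f}"
      using False by auto
    then have "matching_number 2 (E - {{v, w}}) < card V - 1 - 2 choose 2"
      using less.hyps[of "V - {v}" "E - {{v, w}}"] less.prems(1,4) F(1) vw(6) card(1) ge by simp
    moreover have "card ?D \<le> card V - 3"
      using card_forest_le[OF _ F(2) vw(7)] card less.prems(1) by simp
    ultimately show ?thesis
      using del D step by simp
  qed
qed

text \<open>Colour the forest without the leaf edge, then give the leaf the colour opposite to its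
  neighbour. This supplies the bipartiteness that the comparison relation demands.\<close>

lemma forest_2_colouring:
  fixes E :: "'a set set"
  assumes "finite V" "forest E" "edges_on V E"
  shows "\<exists>c :: 'a \<Rightarrow> bool. \<forall>u v. {u, v} \<in> E \<longrightarrow> c u \<noteq> c v"
  using assms
proof (induction "card V" arbitrary: V E rule: less_induct)
  case less
  show ?case
  proof (cases "E = {}")
    case False
    obtain v w where vw: "v \<in> V" "w \<in> V" "v \<noteq> w" "{v, w} \<in> E" "\<forall>f\<in>E. v \<in> f \<longrightarrow> f = {v, w}"
      "edges_on (V - {v}) (E - {{v, w}})" "edges_on (V - {v, w}) {f \<in> E. disjnt {v, w} f}"
      by (rule forest_leaf[OF less.prems(2,3) False]) (rule that)
    have "card (V - {v}) < card V"
      using vw less.prems(1) by (intro card_Diff1_less)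
    moreover have "forest (E - {{v, w}})"
      using forest_subset[OF less.prems(2)] by blast
    ultimately obtain c :: "'a \<Rightarrow> bool" where c: "\<And>x y. {x, y} \<in> E - {{v, w}} \<Longrightarrow> c x \<noteq> c y"
      using less.hyps[of "V - {v}" "E - {{v, w}}"] less.prems(1) vw(6) by (metis finite_Diff)
    have "(c(v := \<not> c w)) x \<noteq> (c(v := \<not> c w)) y" if "{x, y} \<in> E" for x y
    proof (cases "v \<in> {x, y}")
      case True
      then have "{x, y} = {v, w}"
        using vw(5) that True by (metis (no_types))
      then show ?thesis
        using vw(3) by (auto simp: doubleton_eq_iff)
    next
      case False
      then show ?thesis
        using c that by auto
    qed
    then show ?thesis by blast
  qed simp
qed

subsection \<open>Trees\<close>

text \<open>Distinct lists over \<open>V\<close> have length at most \<open>card V\<close>; this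
  provides the longest paths used below.\<close>

lemma successively_extend_maximal:
  assumes "finite V" "P [x0]" "\<And>xs. P xs \<Longrightarrow> distinct xs \<and> set xs \<subseteq> V"
  obtains xs where "P xs" "\<And>ys. P ys \<Longrightarrow> length ys \<le> length xs"
proof -
  have "length ys < Suc (card V)" if "P ys" for ys
    using assms(3)[OF that] assms(1) by (metis card_mono distinct_card less_Suc_eq_le)
  then show thesis
    using ex_has_greatest_nat[of P "[x0]" length] assms(2) that by (metis less_imp_le)
qed

lemma tree_edges_on: "weighted_tree n T \<Longrightarrow> edges_on (verts T) (edges T)"
  by (auto simp: weighted_tree_def weighted_graph_def edges_on_def)

text \<open>In a counterexample \<open>E'\<close> every covered vertex lies on two edges. Take a
  longest path in \<open>E'\<close>: both neighbours of its first vertex \<open>x\<close> lie on the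
  path, and the farther one closes a cycle.\<close>

lemma tree_forest:
  assumes "weighted_tree n T"
  shows "forest (edges T)"
  unfolding forest_def
proof (intro allI impI, rule ccontr)
  fix E' assume E': "E' \<subseteq> edges T" "E' \<noteq> {}" and no: "\<not> (\<exists>v. \<exists>e\<in>E'. v \<in> e \<and> (\<forall>f\<in>E'. v \<in> f \<longrightarrow> f = e))"
  have fin: "finite (verts T)"
    using assms by (auto simp: weighted_tree_def weighted_graph_def)
  have E: "edges_on (verts T) E'"
    using tree_edges_on[OF assms] E'(1) by (auto simp: edges_on_def)
  let ?P = "\<lambda>xs. xs \<noteq> [] \<and> distinct xs \<and> set xs \<subseteq> \<Union>E' \<and> successively (\<lambda>u v. {u, v} \<in> E') xs"
  have sub: "\<Union>E' \<subseteq> verts T"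
    using edges_onE[OF E] by blast
  obtain e where e: "e \<in> E'" using E'(2) by blast
  then obtain x0 where "x0 \<in> e" using edges_onE[OF E] by blast
  then have "?P [x0]" using e by auto
  then obtain xs where xs: "?P xs" and max: "\<And>ys. ?P ys \<Longrightarrow> length ys \<le> length xs"
    using successively_extend_maximal[of "\<Union>E'" ?P x0] sub fin finite_subset by blast
  obtain x zs where Cons: "xs = x # zs" using xs by (cases xs) auto
  \<comment> \<open>A neighbour off the path could be put in front of it, against
    maximality.\<close>
  have neighbour: "\<exists>i. zs ! i = y \<and> i < length zs" if "{x, y} \<in> E'" for y
  proof (rule ccontr)
    assume "\<not> ?thesis"
    moreover have "x \<noteq> y" using edges_onE_at[OF E that, of x] by fastforce
    ultimately have "y \<notin> set xs" by (auto simp: Cons in_set_conv_nth)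
    then have "?P (y # xs)"
      using xs that by (auto simp: Cons insert_commute)
    then show False using max[of "y # xs"] Cons by simp
  qed
  obtain f where f: "f \<in> E'" "x \<in> f" using xs Cons by auto
  obtain g where g: "g \<in> E'" "x \<in> g" "g \<noteq> f" using no f by blast
  obtain y where y: "f = {x, y}" using edges_onE_at[OF E f] .
  obtain z where z: "g = {x, z}" using edges_onE_at[OF E g(1,2)] .
  \<comment> \<open>The two neighbours have different positions in \<open>zs\<close>, so one has
    position at least 1 and its cycle has at least three vertices.\<close>
  have "\<exists>i>0. i < length zs \<and> {x, zs ! i} \<in> E'"
    using neighbour[of y] neighbour[of z] f g y z by (metis neq0_conv)
  then obtain i where i: "i > 0" "i < length zs" "{x, zs ! i} \<in> E'" by blast
  define ys where "ys = x # take (Suc i) zs"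
  have ys: "xs = ys @ drop (Suc i) zs" by (simp add: ys_def Cons)
  have "last ys = zs ! i"
    using i by (simp add: ys_def take_Suc_conv_app_nth)
  moreover have "distinct ys" "set ys \<subseteq> \<Union>E'" "successively (\<lambda>u v. {u, v} \<in> E') ys"
    using xs unfolding ys by (auto simp: successively_append_iff)
  moreover have "length ys \<ge> 3" using i by (simp add: ys_def)
  ultimately have "cycle T ys"
    using i(3) E'(1) sub unfolding cycle_def walk_def
    by (auto simp: ys_def insert_commute elim!: successively_mono)
  then show False
    using assms by (auto simp: weighted_tree_def)
qed

lemma tree_bipartite:
  assumes "weighted_tree n T"
  shows "bipartite T"
proof -
  have fin: "finite (verts T)"
    using assms by (auto simp: weighted_tree_def weighted_graph_def)
  obtain c :: "_ \<Rightarrow> bool" where c: "\<forall>u v. {u, v} \<in> edges T \<longrightarrow> c u \<noteq> c v"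
    using forest_2_colouring[OF fin tree_forest[OF assms] tree_edges_on[OF assms]] by blast
  let ?A = "{v \<in> verts T. c v}" and ?B = "{v \<in> verts T. \<not> c v}"
  have "\<exists>u\<in>?A. \<exists>v\<in>?B. e = {u, v}" if e: "e \<in> edges T" for e
  proof -
    obtain u v where uv: "u \<in> verts T" "v \<in> verts T" "e = {u, v}"
      using edges_onE[OF tree_edges_on[OF assms] e] by blast
    then have "c u \<noteq> c v" using c e by blast
    then show ?thesis
      using uv by (cases "c u") (auto simp: insert_commute)
  qed
  then show ?thesis
    unfolding bipartite_def by (intro exI[of _ ?A] exI[of _ ?B]) auto
qed

section \<open>Trees that are paths\<close>

lemma walk_leaves_set:
  assumes "successively (\<lambda>u v. {u, v} \<in> E) xs" "xs \<noteq> []" "hd xs \<in> S" "last xs \<notin> S"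
  shows "\<exists>x\<in>S. \<exists>y. y \<notin> S \<and> {x, y} \<in> E"
  using assms
proof (induction xs rule: induct_list012)
  case (3 x y zs)
  then show ?case by (cases "y \<in> S") auto
qed auto

text \<open>Take a longest path from \<open>u\<close>. If it misses a vertex, connectedness gives an
  edge from some \<open>x\<close> on it to some \<open>y\<close> off it. If \<open>x\<close> is
  last, the path extends; if \<open>x = u\<close>, its degree is at least 2; otherwise predecessor,
  successor and \<open>y\<close> give degree at least 3.\<close>

lemma tree_spanning_path:
  assumes T: "weighted_tree n T"
    and deg: "\<And>x. degree T x \<le> 2" and u: "u \<in> verts T" "degree T u \<le> 1"
  obtains xs where "distinct xs" "set xs = verts T" "xs \<noteq> []" "hd xs = u"
    "successively (\<lambda>u v. {u, v} \<in> edges T) xs"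
proof -
  have fin: "finite (verts T)"
    using T by (auto simp: weighted_tree_def weighted_graph_def)
  note E = tree_edges_on[OF T]
  have finE: "finite (edges T)" using edges_on_finite[OF E fin] .
  let ?P = "\<lambda>xs. xs \<noteq> [] \<and> hd xs = u \<and> distinct xs \<and> set xs \<subseteq> verts T \<and>
    successively (\<lambda>u v. {u, v} \<in> edges T) xs"
  have "?P [u]" using u by simp
  then obtain xs where xs: "?P xs" and max: "\<And>ys. ?P ys \<Longrightarrow> length ys \<le> length xs"
    using successively_extend_maximal[of "verts T" ?P u] fin by blast
  have step: "{xs ! i, xs ! Suc i} \<in> edges T" if "Suc i < length xs" for i
    using xs that by (simp add: successively_conv_nth)
  have "set xs = verts T"
  proof (rule ccontr)
    assume "set xs \<noteq> verts T"
    then obtain z where z: "z \<in> verts T" "z \<notin> set xs" using xs by blast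
    obtain ws where "walk T ws" "hd ws = u" "last ws = z"
      using T u(1) z(1) unfolding weighted_tree_def connected_graph_def by metis
    then obtain x y where xy: "x \<in> set xs" "y \<notin> set xs" "{x, y} \<in> edges T"
      using walk_leaves_set[of "edges T" ws "set xs"] z xs hd_in_set[of xs] by (auto simp: walk_def)
    then have "y \<in> verts T" using edges_onE_at[OF E xy(3), of y] by blast
    obtain i where i: "x = xs ! i" "i < length xs" using xy by (auto simp: in_set_conv_nth)
    have next_i: "Suc i < length xs"
    proof (rule ccontr)
      assume "\<not> ?thesis"
      then have "x = last xs" using i xs by (metis Suc_lessI diff_Suc_1 last_conv_nth)
      then have "?P (xs @ [y])"
        using xs xy \<open>y \<in> verts T\<close> by (auto simp: successively_append_iff)
      then show False using max[of "xs @ [y]"] by simp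
    qed
    have "y \<noteq> xs ! Suc i" using xy(2) next_i nth_mem by blast
    then have two: "card {{x, y}, {x, xs ! Suc i}} = 2"
      by (auto simp: doubleton_eq_iff)
    show False
    proof (cases i)
      case 0
      then have "x = u" using i xs hd_conv_nth[of xs] by simp
      moreover have "card {{x, y}, {x, xs ! Suc i}} \<le> degree T x"
        unfolding degree_def using finE xy step[OF next_i] i by (intro card_mono) auto
      ultimately show False using two u by simp
    next
      case (Suc j)
      have "xs ! j \<noteq> xs ! Suc i" "xs ! j \<noteq> x" "y \<noteq> xs ! j"
        using xs Suc next_i i nth_eq_iff_index_eq[of xs] xy(2) nth_mem[of j xs] by auto
      then have "card {{xs ! j, x}, {x, y}, {x, xs ! Suc i}} = 3"
        using two by (subst card_insert_disjoint) (auto simp: doubleton_eq_iff)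
      moreover have "card {{xs ! j, x}, {x, y}, {x, xs ! Suc i}} \<le> degree T x"
        unfolding degree_def using finE xy step[OF next_i] step[of j] i Suc by (intro card_mono) auto
      ultimately show False using deg[of x] by simp
    qed
  qed
  then show thesis using that xs by blast
qed

lemma tree_weighted_iso_path_star:
  assumes T: "weighted_tree n T" and n: "n \<ge> 2" and card: "card (edges T) = n - 1"
    and deg: "\<And>x. degree T x \<le> 2"
    and e: "e \<in> edges T" "u \<in> e" "degree T u \<le> 1"
    and w: "weight T e = a" "\<forall>f\<in>edges T - {e}. weight T f = 1"
  shows "weighted_iso T (path_star n a)"
proof -
  have V: "finite (verts T)" "card (verts T) = n"
    using T by (auto simp: weighted_tree_def weighted_graph_def)
  note E = tree_edges_on[OF T]
  have finE: "finite (edges T)" using edges_on_finite[OF E V(1)] .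
  have "u \<in> verts T" using edges_onE_at[OF E e(1,2)] by blast
  then obtain xs where xs: "distinct xs" "set xs = verts T" "xs \<noteq> []" "hd xs = u"
    "successively (\<lambda>u v. {u, v} \<in> edges T) xs"
    using tree_spanning_path[OF T deg _ e(3)] by blast
  have len: "length xs = n" using xs V distinct_card by metis
  define g where "g i = xs ! i" for i
  have bij: "bij_betw g {..<n} (verts T)"
    unfolding g_def using bij_betw_nth[OF xs(1), of "{..<n}" "verts T"] len xs by simp
  have inj: "g i = g j \<longleftrightarrow> i = j" if "i < n" "j < n" for i j
    using xs len that by (simp add: g_def nth_eq_iff_index_eq)
  have step: "{g i, g (Suc i)} \<in> edges T" if "Suc i < n" for i
    unfolding g_def using xs(5) that len by (simp add: successively_conv_nth)
  have inj_step: "inj_on (\<lambda>i. {g i, g (Suc i)}) {..<n - 1}"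
    by (rule inj_onI) (auto simp: doubleton_eq_iff inj)
  \<comment> \<open>The path has \<open>n - 1\<close> distinct steps, and the tree has exactly that
    many edges.\<close>
  have "(\<lambda>i. {g i, g (Suc i)}) ` {..<n - 1} = edges T"
    using finE step card card_image[OF inj_step] by (intro card_subset_eq) auto
  then have edges: "edges T = {{g i, g (Suc i)} | i. Suc i < n}"
    by (simp add: setcompr_eq_image lessThan_def less_diff_conv)
  have "g 0 = u" using xs by (simp add: g_def hd_conv_nth)
  \<comment> \<open>Only one edge meets \<open>u\<close>, so the heavy edge is the first step, as in
    \<open>path_star\<close>.\<close>
  then have "card {e, {g 0, g 1}} \<le> degree T u"
    unfolding degree_def using finE e step[of 0] n by (intro card_mono) auto
  then have e_eq: "e = {g 0, g 1}"
    using e(3) by (cases "e = {g 0, g 1}") auto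
  define f where "f = inv_into {..<n} g"
  have fg: "f (g i) = i" if "i < n" for i
    unfolding f_def using that bij by (intro inv_into_f_f) (auto simp: bij_betw_def)
  have "bij_betw f (verts T) (verts (path_star n a))"
    unfolding f_def path_star_def using bij bij_betw_inv_into by auto
  moreover have f_step: "f ` {g i, g (Suc i)} = {i, Suc i}" if "Suc i < n" for i
    using that by (simp add: fg)
  moreover have "edges (path_star n a) = (\<lambda>e. f ` e) ` edges T"
  proof -
    have "edges (path_star n a) = (\<lambda>i. {i, Suc i}) ` {i. Suc i < n}"
      by (simp add: path_star_def setcompr_eq_image)
    also have "\<dots> = (\<lambda>i. f ` {g i, g (Suc i)}) ` {i. Suc i < n}"
      by (intro image_cong refl) (simp only: f_step mem_Collect_eq)
    finally show ?thesis
      unfolding edges setcompr_eq_image image_image .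
  qed
  moreover have "weight (path_star n a) (f ` d) = weight T d" if d: "d \<in> edges T" for d
  proof -
    obtain i where i: "d = {g i, g (Suc i)}" "Suc i < n" using d unfolding edges by blast
    have "d = e \<longleftrightarrow> i = 0"
      using i e_eq n by (auto simp: doubleton_eq_iff inj)
    moreover have "f ` d = {i, Suc i}" using i f_step by simp
    ultimately show ?thesis
      using w d by (auto simp: path_star_def doubleton_eq_iff)
  qed
  ultimately show ?thesis unfolding weighted_iso_def by blast
qed

text \<open>Turns the multiset of weights into one distinguished edge. Edges occur once in
  \<open>mset_set E\<close>, so taking out \<open>e\<close> leaves
  \<open>mset_set (E - {e})\<close>.\<close>

lemma image_mset_set_add_replicateE:
  assumes "finite E" "image_mset w (mset_set E) = add_mset a (replicate_mset k b)"
  obtains e where "e \<in> E" "w e = a" "\<forall>f\<in>E - {e}. w f = b" "card E = Suc k"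
proof -
  obtain M e where M: "mset_set E = add_mset e M" "w e = a" "image_mset w M = replicate_mset k b"
    using msed_map_invR[OF assms(2)] by blast
  then have "e \<in># mset_set E" by simp
  then have e: "e \<in> E" using assms(1) by simp
  then have "M = mset_set (E - {e})"
    using M(1) assms(1) by (simp add: mset_set_Diff)
  then have "w f = b" if "f \<in> E - {e}" for f
    using that M(3) assms(1) by (metis elem_mset_set finite_Diff imageI in_replicate_mset set_image_mset)
  moreover have "card E = Suc k"
    using arg_cong[OF assms(2), of size] by simp
  ultimately show thesis using that e M(2) by simp
qed

subsection \<open>The path\<close>

text \<open>The start \<open>l\<close> varies because deleting the first edge, or both its ends,
  leaves such a tail again.\<close>

definition path_edges :: "nat \<Rightarrow> nat \<Rightarrow> nat set set" where
  "path_edges l n = {{i, Suc i} | i. l \<le> i \<and> Suc i < n}"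

lemma finite_path_edges: "finite (path_edges l n)"
  by (rule finite_subset[of _ "Pow {..<n}"]) (auto simp: path_edges_def)

lemma path_edges_disjnt:
  "{f \<in> path_edges l n. disjnt {l, Suc l} f} = path_edges (Suc (Suc l)) n"
proof (intro equalityI subsetI)
  fix f assume "f \<in> {f \<in> path_edges l n. disjnt {l, Suc l} f}"
  then obtain i where i: "f = {i, Suc i}" "l \<le> i" "Suc i < n" "disjnt {l, Suc l} f"
    by (auto simp: path_edges_def)
  then have "Suc (Suc l) \<le> i" by (auto simp: disjnt_def)
  then show "f \<in> path_edges (Suc (Suc l)) n" using i by (auto simp: path_edges_def)
qed (auto simp: path_edges_def disjnt_def)

lemma path_edges_remove: "path_edges l n - {{l, Suc l}} = path_edges (Suc l) n"
proof (intro equalityI subsetI)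
  fix f assume "f \<in> path_edges l n - {{l, Suc l}}"
  then obtain i where i: "f = {i, Suc i}" "l \<le> i" "Suc i < n" "i \<noteq> l"
    by (auto simp: path_edges_def)
  then have "Suc l \<le> i" by auto
  then show "f \<in> path_edges (Suc l) n" using i by (auto simp: path_edges_def)
qed (auto simp: path_edges_def doubleton_eq_iff)

text \<open>Deletion at the first edge yields the recurrence of the forest bound, now with equality:
  the path attains it.\<close>

lemma matching_number_path_edges: "matching_number k (path_edges l n) = n - l - k choose k"
proof (induction "n - l" arbitrary: l k rule: less_induct)
  case less
  show ?case
  proof (cases k)
    case (Suc j)
    show ?thesis
    proof (cases "Suc l < n")
      case True
      have "{l, Suc l} \<in> path_edges l n"
        using True by (auto simp: path_edges_def)
      then have "matching_number (Suc j) (path_edges l n) =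
          matching_number (Suc j) (path_edges (Suc l) n) + matching_number j (path_edges (Suc (Suc l)) n)"
        using matching_sum_deletion[OF finite_path_edges, of "{l, Suc l}" l n "\<lambda>_. 1" j]
        by (simp add: path_edges_remove path_edges_disjnt del: disjnt_insert1)
      also have "\<dots> = (n - Suc l - Suc j choose Suc j) + (n - Suc (Suc l) - j choose j)"
        using less True by simp
      also have "\<dots> = n - l - Suc j choose Suc j"
        using choose_step[of "n - l" j] True by simp
      finally show ?thesis using Suc by simp
    next
      case False
      then have "path_edges l n = {}" by (auto simp: path_edges_def)
      \<comment> \<open>Here \<open>n - l \<le> 1\<close>, so the binomial coefficient is
        \<open>0 choose Suc j = 0\<close>.\<close>
      then show ?thesis using False Suc by simp
    qed
  qed simp
qed

text \<open>Expand at the heavy edge \<open>{0, 1}\<close>: as it is pendent, removing its ends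
  leaves one path on \<open>n - 2\<close> vertices, so both terms attain their bounds.\<close>

lemma b_coeff_path_star:
  fixes a :: real
  assumes "n \<ge> 2"
  shows "b_coeff (Suc k) (path_star n a) =
    real (n - Suc k choose Suc k) + (a\<^sup>2 - 1) * real (n - 2 - k choose k)"
proof -
  have E: "edges (path_star n a) = path_edges 0 n"
    by (simp add: path_star_def path_edges_def)
  have w: "weight (path_star n a) = (\<lambda>e. if e = {0, Suc 0} then a else 1)"
    by (simp add: path_star_def)
  have "{0, Suc 0} \<in> path_edges 0 n" using assms by (auto simp: path_edges_def)
  then have "b_coeff (Suc k) (path_star n a) = matching_number (Suc k) (path_edges 0 n) +
      (a\<^sup>2 - 1) * matching_number k (path_edges (Suc (Suc 0)) n)"
    using matching_sum_heavy_edge[OF finite_path_edges, of "{0, Suc 0}" 0 n "weight (path_star n a)" k]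
    by (simp add: b_coeff_eq_matching_sum E w path_edges_disjnt del: disjnt_insert1)
  then show ?thesis
    by (simp add: matching_number_path_edges numeral_2_eq_2)
qed

lemma weighted_graph_path_star: "weighted_graph n (path_star n a)"
proof -
  have "\<exists>u\<in>{..<n}. \<exists>v\<in>{..<n}. u \<noteq> v \<and> {i, Suc i} = {u, v}" if "Suc i < n" for i
    using that by (intro bexI[of _ i] bexI[of _ "Suc i"]) auto
  then show ?thesis
    by (auto simp: weighted_graph_def path_star_def)
qed

lemma bipartite_path_star: "bipartite (path_star n a)"
proof -
  have "\<exists>u\<in>{i. i < n \<and> even i}. \<exists>v\<in>{i. i < n \<and> odd i}. {i, Suc i} = {u, v}" if "Suc i < n" for i
  proof (cases "even i")
    case True
    then show ?thesis
      using that by (intro bexI[of _ i] bexI[of _ "Suc i"]) auto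
  next
    case False
    then show ?thesis
      using that by (intro bexI[of _ i] bexI[of _ "Suc i"]) auto
  qed
  then show ?thesis
    unfolding bipartite_def path_star_def
    by (intro exI[of _ "{i. i < n \<and> even i}"] exI[of _ "{i. i < n \<and> odd i}"]) auto
qed

section \<open>Comparison of the coefficients\<close>

theorem theorem7:
  fixes n m :: nat and a :: real and T :: "'a wgraph"
  assumes "n \<ge> 3" and "m \<ge> n" and "a = real m - real n + 2"
    and "T \<in> trees_with_weights n (add_mset a (replicate_mset (n - 2) 1))"
    and "\<not> weighted_iso T (path_star n a)"
  shows "b_prec n T (path_star n a)"
proof -
  have T: "weighted_tree n T"
    and W: "image_mset (weight T) (mset_set (edges T)) = add_mset a (replicate_mset (n - 2) 1)"
    using assms(4) by (auto simp: trees_with_weights_def)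
  have V: "finite (verts T)" "card (verts T) = n" and graph: "weighted_graph n T"
    using T by (auto simp: weighted_tree_def weighted_graph_def)
  note E = tree_edges_on[OF T] and F = tree_forest[OF T]
  have finE: "finite (edges T)" using edges_on_finite[OF E V(1)] .
  obtain e where e: "e \<in> edges T" "weight T e = a" "\<forall>f\<in>edges T - {e}. weight T f = 1"
    and "card (edges T) = Suc (n - 2)"
    by (rule image_mset_set_add_replicateE[OF finE W]) (rule that)
  then have cardE: "card (edges T) = n - 1" using assms(1) by simp
  obtain u v where uv: "u \<in> verts T" "v \<in> verts T" "u \<noteq> v" "e = {u, v}"
    using edges_onE[OF E e(1)] .
  \<comment> \<open>From \<open>m \<ge> n\<close> comes \<open>a \<ge> 2\<close>; bounds on the
    second term thus keep their direction and strictness.\<close>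
  have a: "a\<^sup>2 - 1 > 0"
    using assms(2,3) power_strict_mono[of 1 a 2] by simp
  let ?D = "{f \<in> edges T. disjnt e f}"
  have D: "edges_on (verts T - {u, v}) ?D"
    using edges_on_disjnt[OF E, of e] uv(4) by simp
  have cardD: "card (verts T - {u, v}) = n - 2"
    using uv V by (simp add: card_Diff_subset)
  have b: "b_coeff (Suc k) T =
      matching_number (Suc k) (edges T) + (a\<^sup>2 - 1) * matching_number k ?D" for k
    using matching_sum_heavy_edge[OF finE e(1), of "weight T" k] uv(4) e(2,3)
    by (simp add: b_coeff_eq_matching_sum)
  have le1: "matching_number k (edges T) \<le> n - k choose k" for k
    using matching_number_forest_le[OF V(1) F E] V(2) by simp
  have le2: "matching_number k ?D \<le> n - 2 - k choose k" for k
    using matching_number_forest_le[OF _ forest_subset[OF F] D] V(1) cardD by simp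
  have le: "b_coeff k T \<le> b_coeff k (path_star n a)" if k: "k \<in> {1..n div 2}" for k
  proof -
    obtain j where "k = Suc j" using k by (cases k) auto
    then show ?thesis
      using b[of j] b_coeff_path_star[of n j a] assms(1) le1[of k] le2[of j] a
      by (simp add: add_mono)
  qed
  \<comment> \<open>The first coefficient is the sum of the squared weights and agrees for both
    graphs, so strictness is sought at 2.\<close>
  have path2: "b_coeff 2 (path_star n a) = (n - 2 choose 2) + (a\<^sup>2 - 1) * (n - 3)"
    using b_coeff_path_star[of n 1 a] assms(1) by (simp add: choose_one del: One_nat_def)
  have b2: "b_coeff 2 T = matching_number 2 (edges T) + (a\<^sup>2 - 1) * card ?D"
    using b[of 1] matching_number_1[of ?D] finE edges_on_nonempty[OF D] by (simp del: One_nat_def)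
  have D_le: "card ?D \<le> n - 3"
    using card_forest_le[OF _ forest_subset[OF F] D] V(1) cardD by simp
  have M_le: "matching_number 2 (edges T) \<le> n - 2 choose 2"
    using le1[of 2] by simp
  \<comment> \<open>With all degrees at most 2 and an end of \<open>e\<close> of degree at most 1,
    the tree would be the excluded path.\<close>
  have "\<not> (\<forall>x. degree T x \<le> 2) \<or> (degree T u \<ge> 2 \<and> degree T v \<ge> 2)"
    using tree_weighted_iso_path_star[OF T _ cardE _ e(1) _ _ e(2,3)] assms(1,5) uv(4) by force
  then have "n \<ge> 4 \<and> b_coeff 2 T < b_coeff 2 (path_star n a)"
  proof
    assume "\<not> (\<forall>x. degree T x \<le> 2)"
    then obtain x where "\<not> degree T x \<le> 2"
      by blast
    then have x: "card {f \<in> edges T. x \<in> f} \<ge> 3"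
      by (simp add: degree_def)
    have "card {f \<in> edges T. x \<in> f} \<le> card (edges T)"
      using finE by (intro card_mono) auto
    moreover have "(a\<^sup>2 - 1) * card ?D \<le> (a\<^sup>2 - 1) * (n - 3)"
      using D_le a assms(1) by (intro mult_left_mono) auto
    ultimately show ?thesis
      using x cardE matching_number_2_forest_less[OF V(1) F E x] V(2) b2 path2 by simp
  next
    assume deg: "degree T u \<ge> 2 \<and> degree T v \<ge> 2"
    \<comment> \<open>The edges at the two ends share only \<open>e\<close>, so they number at least
      2 + 2 - 1 = 3, and at most \<open>n - 4\<close> edges avoid both ends.\<close>
    let ?U = "{f \<in> edges T. u \<in> f}" and ?V = "{f \<in> edges T. v \<in> f}"
    have "f = e" if "f \<in> ?U \<inter> ?V" for f
      using that E uv by (auto simp: edges_on_def)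
    then have "?U \<inter> ?V = {e}"
      using e(1) uv(4) by auto
    then have "card (?U \<union> ?V) \<ge> 3"
      using card_Un_Int[of ?U ?V] finE deg by (simp add: degree_def)
    moreover have "card (?U \<union> ?V) \<le> card (edges T)"
      using finE by (intro card_mono) auto
    moreover have "?D = edges T - (?U \<union> ?V)"
      using uv(4) by (auto simp: disjnt_def)
    then have "card ?D = card (edges T) - card (?U \<union> ?V)"
      using finE by (simp add: card_Diff_subset)
    ultimately have "n \<ge> 4" "card ?D < n - 3"
      using cardE by auto
    then have "(a\<^sup>2 - 1) * card ?D < (a\<^sup>2 - 1) * (n - 3)"
      using a by (intro mult_strict_left_mono) auto
    then show ?thesis
      using M_le b2 path2 \<open>n \<ge> 4\<close> by simp
  qed
  \<comment> \<open>The bound \<open>n \<ge> 4\<close> puts the index 2 in the required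
    range.\<close>
  then have "\<exists>j\<in>{1..n div 2}. b_coeff j T < b_coeff j (path_star n a)"
    by (intro bexI[of _ 2]) auto
  then show ?thesis
    using le graph tree_bipartite[OF T] weighted_graph_path_star bipartite_path_star
    by (auto simp: b_prec_def b_preceq_def)
qed

end
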